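(* Let $\mathbf{X}\in\mathbb{R}^{n\times d}$ satisfy $\operatorname{diag}\left(\frac1n \mathbf{X}^\top\mathbf{X}\right)=\mathbf{I}$, let $\mathbf{y}\in\mathbb{R}^n$, let $\mathcal{L}(\mathbf{w})=\frac{1}{2n}\|\mathbf{y}-\mathbf{X}\mathbf{w}\|_2^2$ for $\mathbf{w}\in\mathbb{R}^d$, and let $\lambda>0$. Let $\widehat{\boldsymbol\eta}:\mathbb{R}^d\to\mathcal{H}\subseteq[0,\infty]^d$ be a separable update function, i.e. its $j$-th coordinate $\widehat\eta_j(w_j)$ depends only on $w_j$. Suppose that for every $j$, $$\widehat\alpha_j(w_j):=\frac{\widehat\eta_j(w_j)}{\widehat\eta_j(w_j)+\lambda}$$ is a monotonically increasing differentiable function of $|w_j|$. Then there exist separable functions $f:\mathcal{H}\to[-\infty,\infty]$ and $\Omega:\mathbb{R}^d\to[-\infty,\infty]$ such that $\Omega$ is concave in $\mathbf{w}^{\odot2}$ and, for all $\mathbf{w}\in\mathbb{R}^d$, $$\widehat{\boldsymbol\eta}(\mathbf{w})=\arg\min_{\boldsymbol\eta\in\mathcal{H}}\mathcal{J}(\mathbf{w},\boldsymbol\eta)\qquad\text{and}\qquad\min_{\boldsymbol\eta\in\mathcal{H}}\mathcal{J}(\mathbf{w},\boldsymbol\eta)=\mathcal{L}(\mathbf{w})+\lambda\,\Omega(\mathbf{w}),$$ where $\mathcal{J}(\mathbf{w},\boldsymbol\eta)=\mathbb{E}_{\mathbf{s}}[\mathcal{L}(\mathbf{s}\odot\mathbf{w})]+\frac{\lambda}{2}f(\boldsymbol\eta)$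 is the adaptive dropout objective defined in the context.
   Context: Notation. $\odot$ denotes element-wise multiplication, and $\mathbf{u}^{\odot p}$ the element-wise $p$-th power. $\operatorname{diag}$ of a matrix is that matrix with all off-diagonal entries set to zero. $\arg\min$ denotes a minimizer. A function of a vector is separable if it is a sum of functions of the individual coordinates. Dropout masks. For $\boldsymbol\alpha\in[0,1]^d$, $\mathbf{s}\sim\textsc{Mask}(\boldsymbol\alpha)$ is a random vector in $\mathbb{R}^d$ with independent coordinates satisfying $\mathbb{E}[s_j]=1$ and $\mathbb{E}[s_j^2]=\alpha_j^{-1}$ (for example $s_j=\alpha_j^{-1}$ with probability $\alpha_j$ and $s_j=0$ otherwise, or $s_j\sim\mathcal{N}(1,\alpha_j^{-1}-1)$). Adaptive dropout objective. Fix $\lambda>0$. A parameter $\boldsymbol\eta\in\mathcal{H}\subseteq[0,\infty]^d$ determines $\boldsymbol\alpha$ by $\alpha_j=\frac{\eta_j}{\eta_j+\lambda}$ (equivalently $\eta_j=\lambda(\alpha_j^{-1}-1)^{-1}$), with $\alpha_j=1$ if $\eta_j=\infty$ and $\alpha_j=0$ if $\eta_j=0$. Given $f:\mathcal{H}\to[-\infty,\infty]$, $$\mathcal{J}(\mathbf{w},\boldsymbol\eta)=\mathbb{E}_{\mathbf{s}\sim\textsc{Mask}(\boldsymbol\alpha)}\left[\mathcal{L}(\mathbf{s}\odot\mathbf{w})\right]+\frac{\lambda}{2}f(\boldsymbol\eta).$$ Convention when some $\alpha_j=0$ (i.e. $\eta_j=0$): the expectation is $+\infty$ if $w_j\neq0$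 for some such $j$, and coordinates with $\alpha_j=0$ and $w_j=0$ contribute $s_jw_j=0$. Concavity. $\Omega$ is "concave in $\mathbf{w}^{\odot2}$" (subquadratic) if $\Omega(\mathbf{w})=g(\mathbf{w}^{\odot 2})$ for a concave function $g$ on $[0,\infty)^d$. *)

theory Defs
  imports "HOL-Probability.Probability"
begin

(* On vectors, * and ^ are the library's componentwise operations. *)

definition diag_part :: "real^'d^'d \<Rightarrow> real^'d^'d" where
  "diag_part A = (\<chi> i j. if i = j then A $ i $ j else 0)"

definition sq_loss :: "real^'d^'n \<Rightarrow> real^'n \<Rightarrow> real^'d \<Rightarrow> real" where
  "sq_loss X y w = (1 / (2 * real CARD('n))) * (norm (y - X *v w))\<^sup>2"

definition keep_prob :: "real \<Rightarrow> ennreal \<Rightarrow> real" where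
  "keep_prob lam e = (if e = \<infinity> then 1 else enn2real e / (enn2real e + lam))"

(* The law of a dropout mask. A coordinate with alpha_j = 0 would need an infinite second
   moment; it is left unconstrained, because its value never matters: see expected_loss. *)
definition is_mask :: "real^'d \<Rightarrow> (real^'d) measure \<Rightarrow> bool" where
  "is_mask \<alpha> S \<longleftrightarrow>
     prob_space S \<and> sets S = sets borel \<and>
     prob_space.indep_vars S (\<lambda>_. borel) (\<lambda>j s. s $ j) UNIV \<and>
     (\<forall>j. \<alpha> $ j \<noteq> 0 \<longrightarrow>
        has_bochner_integral S (\<lambda>s. s $ j) 1 \<and>
        has_bochner_integral S (\<lambda>s. (s $ j)\<^sup>2) (1 / \<alpha> $ j))"

(* A choice of one mask law for every parameter in [0,1]^d. *)
definition mask_family :: "(real^'d \<Rightarrow> (real^'d) measure) \<Rightarrow> bool" where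
  "mask_family Mask \<longleftrightarrow> (\<forall>\<alpha>. (\<forall>j. \<alpha> $ j \<in> {0..1}) \<longrightarrow> is_mask \<alpha> (Mask \<alpha>))"

(* The expectation is a Bochner integral; the loss is meant to be integrable under the mask
   laws, as every quadratic loss is. *)
definition expected_loss ::
  "(real^'d \<Rightarrow> (real^'d) measure) \<Rightarrow> (real^'d \<Rightarrow> real) \<Rightarrow> real^'d \<Rightarrow> real^'d \<Rightarrow> ereal" where
  "expected_loss Mask L w \<alpha> =
     (if \<exists>j. \<alpha> $ j = 0 \<and> w $ j \<noteq> 0 then \<infinity> else ereal (\<integral>s. L (s * w) \<partial>Mask \<alpha>))"

(* Sums in ereal follow the library's convention \<infinity> + (-\<infinity>) = \<infinity>. It is needed here:
   the penalty f may have to be -\<infinity> at eta_j = 0, where the expected loss is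
   \<infinity> for w_j \<noteq> 0. *)
definition dropout_objective ::
  "(real^'d \<Rightarrow> (real^'d) measure) \<Rightarrow> (real^'d \<Rightarrow> real) \<Rightarrow> real \<Rightarrow> (ennreal^'d \<Rightarrow> ereal) \<Rightarrow>
   real^'d \<Rightarrow> ennreal^'d \<Rightarrow> ereal" where
  "dropout_objective Mask L lam f w \<eta> =
     expected_loss Mask L w (\<chi> j. keep_prob lam (\<eta> $ j)) + ereal (lam / 2) * f \<eta>"

definition separable_on :: "('a^'d) set \<Rightarrow> ('a^'d \<Rightarrow> ereal) \<Rightarrow> bool" where
  "separable_on A F \<longleftrightarrow> (\<exists>\<phi>. \<forall>x\<in>A. F x = (\<Sum>j\<in>UNIV. \<phi> j (x $ j)))"

(* Concavity of an extended-real function, as convexity of its hypograph: the library's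
   concave_on is restricted to real values. *)
definition ereal_concave_on :: "'a::real_vector set \<Rightarrow> ('a \<Rightarrow> ereal) \<Rightarrow> bool" where
  "ereal_concave_on A g \<longleftrightarrow> convex {(u, t :: real). u \<in> A \<and> ereal t \<le> g u}"

definition concave_in_square :: "(real^'d \<Rightarrow> ereal) \<Rightarrow> bool" where
  "concave_in_square \<Omega> \<longleftrightarrow>
     (\<exists>g. ereal_concave_on {u. \<forall>j. 0 \<le> u $ j} g \<and> (\<forall>w. \<Omega> w = g (w\<^sup>2)))"

end

(* The design is normalised, so dropout noise adds sum_j (1/alpha_j - 1) w_j^2 / 2 to the loss;
   in q_j = w_j^2 the objective is affine, with slope a decreasing function of alpha_j. The slope
   prescribed by the update is a decreasing function of q_j, hence (divided by lam) the derivative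
   of a concave function G_j. Taking f to be twice the sum of the concave conjugates of the G_j
   makes the tangent at q_j, i.e. the prescribed parameter, minimise the objective, with minimal
   value L(w) + lam * sum_j G_j(q_j). To cover q_j = 0, where G_j may be -infinity, G_j is defined
   as the infimum of its tangents at positive points. *)
theory Submission
  imports Defs
begin

section \<open>Antiderivatives of decreasing functions on the positive half-line\<close>

text \<open>A primitive works: monotonicity compares the integral of \<open>c\<close> between
  \<open>p\<close> and \<open>q\<close> with that of the constant \<open>c p\<close>. The base point
  is 1 because \<open>c\<close> may be non-integrable near 0.\<close>

lemma antimono_antiderivative:
  fixes c :: "real \<Rightarrow> real"
  assumes c: "\<And>p q. 0 < p \<Longrightarrow> p \<le> q \<Longrightarrow> c q \<le> c p"
  shows "\<exists>F. \<forall>p>0. \<forall>q>0. F q \<le> F p + c p * (q - p)"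
proof -
  \<comment> \<open>One of the two intervals is always empty or a point, so this is the oriented
    integral from 1 to \<open>q\<close>.\<close>
  define F where "F q = integral {1..q} c - integral {q..1} c" for q
  have int: "c integrable_on {a..b}" if "0 < a" for a b
  proof -
    have "mono_on {a..b} (\<lambda>x. - c x)"
      using c that by (auto simp: monotone_on_def)
    from integrable_on_mono_on[OF this] show ?thesis
      by (simp add: integrable_neg_iff)
  qed
  have diff: "F b - F a = integral {a..b} c" if "0 < a" "a \<le> b" for a b
  proof -
    note comb = Henstock_Kurzweil_Integration.integral_combine[of _ _ _ c]
    have empty: "integral {v..u} c = 0" if "u \<le> v" for u v
      using that by (cases "u = v") auto
    consider "b \<le> 1" | "a \<le> 1" "1 \<le> b" | "1 \<le> a" by linarith
    then show ?thesis
    proof cases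
      case 1
      then show ?thesis
        using comb[of a b 1] that int[of a 1] empty[of a 1] empty[of b 1] by (simp add: F_def)
    next
      case 2
      then show ?thesis
        using comb[of a 1 b] that int[of a b] empty[of a 1] empty[of 1 b] by (simp add: F_def)
    next
      case 3
      then show ?thesis
        using comb[of 1 a b] that int[of 1 b] empty[of 1 a] empty[of 1 b] by (simp add: F_def)
    qed
  qed
  have "F q \<le> F p + c p * (q - p)" if "0 < p" "0 < q" for p q
  proof (cases "p \<le> q")
    case True
    have "integral {p..q} c \<le> integral {p..q} (\<lambda>_. c p)"
      using that c int by (intro integral_le) auto
    with diff[of p q] that True show ?thesis by (simp add: mult.commute)
  next
    case False
    have "integral {q..p} (\<lambda>_. c p) \<le> integral {q..p} c"
      using that c int by (intro integral_le) auto
    with diff[of q p] that False show ?thesis by (simp add: algebra_simps)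
  qed
  then show ?thesis by blast
qed

section \<open>Mask moments and the expected quadratic loss\<close>

text \<open>Moments are taken of \<open>s $ j * w $ j\<close> since a coordinate with \<alpha>_j = 0
  has no prescribed moments; there the factor \<open>w $ j\<close> vanishes. The correction term is
  the covariance, zero off the diagonal by independence.\<close>

lemma mask_moments:
  assumes mask: "is_mask \<alpha> S" and w: "\<And>j. \<alpha> $ j = 0 \<Longrightarrow> w $ j = 0"
  shows mask_first_moment: "has_bochner_integral S (\<lambda>s. s $ j * w $ j) (w $ j)"
    and mask_second_moment: "has_bochner_integral S (\<lambda>s. (s $ j * w $ j) * (s $ k * w $ k))
           (w $ j * w $ k + (if j = k then (1 / \<alpha> $ j - 1) * (w $ j)\<^sup>2 else 0))"
proof -
  interpret prob_space S using mask by (simp add: is_mask_def)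
  have first: "has_bochner_integral S (\<lambda>s. s $ j) 1"
    and second: "has_bochner_integral S (\<lambda>s. (s $ j)\<^sup>2) (1 / \<alpha> $ j)" if "w $ j \<noteq> 0" for j
    using mask w that by (auto simp: is_mask_def)
  show "has_bochner_integral S (\<lambda>s. s $ j * w $ j) (w $ j)"
  proof (cases "w $ j = 0")
    case False
    from has_bochner_integral_mult_left[OF first[OF this], of "w $ j"] show ?thesis by simp
  qed (simp add: has_bochner_integral_zero)
  show "has_bochner_integral S (\<lambda>s. (s $ j * w $ j) * (s $ k * w $ k))
           (w $ j * w $ k + (if j = k then (1 / \<alpha> $ j - 1) * (w $ j)\<^sup>2 else 0))"
  proof -
    consider "w $ j = 0 \<or> w $ k = 0" | "j = k" "w $ j \<noteq> 0" | "j \<noteq> k" "w $ j \<noteq> 0" "w $ k \<noteq> 0"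
      by blast
    then show ?thesis
    proof cases
      case 1
      then show ?thesis by (auto simp: has_bochner_integral_zero)
    next
      case 2
      from has_bochner_integral_mult_left[OF second[OF 2(2)], of "(w $ j)\<^sup>2"]
      show ?thesis using 2 by (simp add: power2_eq_square algebra_simps)
    next
      case 3
      have indep: "indep_vars (\<lambda>_. borel) (\<lambda>i s. s $ i) {j, k}"
        by (rule indep_vars_subset[of _ _ UNIV]) (use mask in \<open>auto simp: is_mask_def\<close>)
      have int: "integrable S (\<lambda>s. s $ i)" "(\<integral>s. s $ i \<partial>S) = 1" if "i \<in> {j, k}" for i
        using first[of i] 3 that by (auto simp: has_bochner_integral_iff)
      have "has_bochner_integral S (\<lambda>s. s $ j * s $ k) 1"
        using indep_vars_integrable[OF _ indep] indep_vars_lebesgue_integral[OF _ indep] int 3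
        by (simp add: has_bochner_integral_iff)
      from has_bochner_integral_mult_left[OF this, of "w $ j * w $ k"]
      show ?thesis using 3 by (simp add: algebra_simps)
    qed
  qed
qed

text \<open>Bias-variance decomposition of one residual, with \<open>a\<close> a response and
  \<open>x\<close> a row of the design: the variances add because distinct coordinates are
  uncorrelated.\<close>

lemma has_bochner_integral_affine_square:
  fixes x :: "real^'d"
  assumes mask: "is_mask \<alpha> S" and w: "\<And>j. \<alpha> $ j = 0 \<Longrightarrow> w $ j = 0"
  shows "has_bochner_integral S (\<lambda>s. (a - (\<Sum>k\<in>UNIV. x $ k * (s $ k * w $ k)))\<^sup>2)
           ((a - (\<Sum>k\<in>UNIV. x $ k * w $ k))\<^sup>2
             + (\<Sum>k\<in>UNIV. (x $ k)\<^sup>2 * ((1 / \<alpha> $ k - 1) * (w $ k)\<^sup>2)))"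
proof -
  interpret prob_space S using mask by (simp add: is_mask_def)
  let ?V = "\<lambda>j k. if j = k then (1 / \<alpha> $ j - 1) * (w $ j)\<^sup>2 else 0"
  have expand: "(a - (\<Sum>k\<in>UNIV. x $ k * z k))\<^sup>2
      = a\<^sup>2 - (\<Sum>k\<in>UNIV. 2 * a * x $ k * z k)
        + (\<Sum>j\<in>UNIV. \<Sum>k\<in>UNIV. x $ j * x $ k * (z j * z k))" for z
    by (simp add: power2_eq_square sum_product sum_distrib_left algebra_simps)
  have const: "has_bochner_integral S (\<lambda>s. a\<^sup>2) (a\<^sup>2)"
    by (simp add: has_bochner_integral_iff prob_space)
  have "(\<Sum>j\<in>UNIV. \<Sum>k\<in>UNIV. x $ j * x $ k * ?V j k)
      = (\<Sum>k\<in>UNIV. (x $ k)\<^sup>2 * ((1 / \<alpha> $ k - 1) * (w $ k)\<^sup>2))"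
    by (simp add: if_distrib power2_eq_square cong: if_cong)
  \<comment> \<open>The claimed value is brought into the shape of \<open>expand\<close>, so that
    the integral can be built term by term.\<close>
  then have moment: "(a - (\<Sum>k\<in>UNIV. x $ k * w $ k))\<^sup>2
        + (\<Sum>k\<in>UNIV. (x $ k)\<^sup>2 * ((1 / \<alpha> $ k - 1) * (w $ k)\<^sup>2))
      = a\<^sup>2 - (\<Sum>k\<in>UNIV. 2 * a * x $ k * w $ k)
        + (\<Sum>j\<in>UNIV. \<Sum>k\<in>UNIV. x $ j * x $ k * (w $ j * w $ k + ?V j k))"
    unfolding expand distrib_left sum.distrib by simp
  show ?thesis
    unfolding expand[of "\<lambda>k. s $ k * w $ k" for s] moment
    by (intro has_bochner_integral_add has_bochner_integral_diff const has_bochner_integral_sum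
        has_bochner_integral_mult_right mask_moments[OF mask w])
qed

text \<open>Summing the variances over the rows gives the noise in coordinate \<open>k\<close> the
  squared norm of column \<open>k\<close> as weight; the normalisation makes it \<open>n\<close>,
  cancelling the factor of the loss.\<close>

lemma expected_sq_loss:
  fixes X :: "real^'d^'n"
  assumes X: "diag_part ((1 / real CARD('n)) *\<^sub>R (transpose X ** X)) = mat 1"
    and mask: "is_mask \<alpha> S" and w: "\<And>j. \<alpha> $ j = 0 \<Longrightarrow> w $ j = 0"
  shows "(\<integral>s. sq_loss X y (s * w) \<partial>S)
           = sq_loss X y w + (\<Sum>k\<in>UNIV. (1 / \<alpha> $ k - 1) / 2 * (w $ k)\<^sup>2)"
proof -
  let ?n = "real CARD('n)"
  have loss: "sq_loss X y v = 1 / (2 * ?n) * (\<Sum>i\<in>UNIV. (y $ i - (\<Sum>k\<in>UNIV. X $ i $ k * v $ k))\<^sup>2)" for v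
    by (simp add: sq_loss_def power2_norm_eq_inner inner_vec_def matrix_vector_mult_def
        flip: power2_eq_square)
  have col: "(\<Sum>i\<in>UNIV. (X $ i $ k)\<^sup>2) = ?n" for k
  proof -
    have "diag_part ((1 / ?n) *\<^sub>R (transpose X ** X)) $ k $ k = (1 / ?n) * (\<Sum>i\<in>UNIV. (X $ i $ k)\<^sup>2)"
      by (simp add: diag_part_def matrix_matrix_mult_def transpose_def power2_eq_square)
    then show ?thesis by (simp add: X mat_def)
  qed
  have "has_bochner_integral S
      (\<lambda>s. 1 / (2 * ?n) * (\<Sum>i\<in>UNIV. (y $ i - (\<Sum>k\<in>UNIV. X $ i $ k * (s $ k * w $ k)))\<^sup>2))
      (1 / (2 * ?n) * (\<Sum>i\<in>UNIV. (y $ i - (\<Sum>k\<in>UNIV. X $ i $ k * w $ k))\<^sup>2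
             + (\<Sum>k\<in>UNIV. (X $ i $ k)\<^sup>2 * ((1 / \<alpha> $ k - 1) * (w $ k)\<^sup>2))))"
    by (intro has_bochner_integral_mult_right has_bochner_integral_sum
        has_bochner_integral_affine_square[OF mask w])
  then have "(\<integral>s. sq_loss X y (s * w) \<partial>S) = sq_loss X y w
      + 1 / (2 * ?n) * (\<Sum>i\<in>UNIV. \<Sum>k\<in>UNIV. (X $ i $ k)\<^sup>2 * ((1 / \<alpha> $ k - 1) * (w $ k)\<^sup>2))"
    by (simp add: loss has_bochner_integral_iff sum.distrib distrib_left)
  also have "(\<Sum>i\<in>UNIV. \<Sum>k\<in>UNIV. (X $ i $ k)\<^sup>2 * ((1 / \<alpha> $ k - 1) * (w $ k)\<^sup>2))
      = ?n * (\<Sum>k\<in>UNIV. (1 / \<alpha> $ k - 1) * (w $ k)\<^sup>2)"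
    by (subst sum.swap) (simp add: col flip: sum_distrib_right sum_distrib_left)
  also have "1 / (2 * ?n) * (?n * (\<Sum>k\<in>UNIV. (1 / \<alpha> $ k - 1) * (w $ k)\<^sup>2))
      = (\<Sum>k\<in>UNIV. (1 / \<alpha> $ k - 1) / 2 * (w $ k)\<^sup>2)"
    by (simp add: sum_divide_distrib)
  finally show ?thesis .
qed

section \<open>Concave functions with prescribed slopes\<close>

text \<open>An infimum of tangents is concave, and at a positive point the tangent drawn there is
  the lowest. The last two clauses provide supergradients: \<open>c p\<close> at
  \<open>p > 0\<close>, and at 0 any upper bound of all slopes.\<close>

lemma concave_envelope:
  fixes c :: "real \<Rightarrow> real"
  assumes c: "\<And>p q. 0 < p \<Longrightarrow> p \<le> q \<Longrightarrow> c q \<le> c p"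
  obtains G :: "real \<Rightarrow> ereal" where
    "\<And>q. 0 < q \<Longrightarrow> \<bar>G q\<bar> \<noteq> \<infinity>" "\<And>q. G q \<noteq> \<infinity>" "ereal_concave_on UNIV G"
    "\<And>p r. 0 < p \<Longrightarrow> G r \<le> G p + ereal (c p * (r - p))"
    "\<And>C r. (\<And>p. 0 < p \<Longrightarrow> c p \<le> C) \<Longrightarrow> 0 \<le> r \<Longrightarrow> G r \<le> G 0 + ereal (C * r)"
proof -
  obtain F where F: "\<And>p q. 0 < p \<Longrightarrow> 0 < q \<Longrightarrow> F q \<le> F p + c p * (q - p)"
    using antimono_antiderivative[of c] c by blast
  define G where "G q = (INF p\<in>{0<..}. ereal (F p + c p * (q - p)))" for q
  have le: "G q \<le> ereal (F p + c p * (q - p))" if "0 < p" for p q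
    unfolding G_def by (rule INF_lower) (use that in simp)
  have G_pos: "G q = ereal (F q)" if "0 < q" for q
  proof (rule antisym)
    show "G q \<le> ereal (F q)" using le[of q q] that by simp
    show "ereal (F q) \<le> G q" unfolding G_def by (rule INF_greatest) (use F that in simp)
  qed
  show ?thesis
  proof
    show "\<bar>G q\<bar> \<noteq> \<infinity>" if "0 < q" for q using G_pos[OF that] by simp
    show "G q \<noteq> \<infinity>" for q using le[of 1 q] by auto
    show "ereal_concave_on UNIV G"
      unfolding ereal_concave_on_def
    proof (rule convexI, clarsimp)
      fix u s v t a b :: real
      assume h: "ereal s \<le> G u" "ereal t \<le> G v" "0 \<le> a" "0 \<le> b" "a + b = 1"
      show "ereal (a * s + b * t) \<le> G (a * u + b * v)"
        unfolding G_def
      proof (rule INF_greatest)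
        fix p :: real assume "p \<in> {0<..}"
        then have "s \<le> F p + c p * (u - p)" "t \<le> F p + c p * (v - p)"
          using order_trans[OF h(1) le[of p u]] order_trans[OF h(2) le[of p v]] by simp_all
        then have "a * s + b * t \<le> a * (F p + c p * (u - p)) + b * (F p + c p * (v - p))"
          using h by (intro add_mono mult_left_mono) auto
        also have "\<dots> = (a + b) * (F p - c p * p) + c p * (a * u + b * v)"
          by (simp add: algebra_simps)
        finally show "ereal (a * s + b * t) \<le> ereal (F p + c p * (a * u + b * v - p))"
          using h by (simp add: algebra_simps)
      qed
    qed
    show "G r \<le> G p + ereal (c p * (r - p))" if "0 < p" for p r
      using le[of p r] G_pos[of p] that by simp
    show "G r \<le> G 0 + ereal (C * r)" if C: "\<And>p. 0 < p \<Longrightarrow> c p \<le> C" and "0 \<le> r" for C r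
    proof -
      \<comment> \<open>With \<open>G 0\<close> alone on the right, the tangents can be treated one
        at a time: from 0 to \<open>r\<close> each rises by \<open>c p * r\<close>, at most
        \<open>C * r\<close>.\<close>
      have "G r - ereal (C * r) \<le> G 0"
        unfolding G_def[of 0]
      proof (rule INF_greatest)
        fix p :: real assume p: "p \<in> {0<..}"
        have "c p * r \<le> C * r" using C p that by (simp add: mult_right_mono)
        then have "ereal (F p + c p * (r - p)) \<le> ereal (F p + c p * (0 - p)) + ereal (C * r)"
          by (simp add: algebra_simps)
        with le[of p r] p show "G r - ereal (C * r) \<le> ereal (F p + c p * (0 - p))"
          by (auto simp: ereal_minus_le intro: order_trans)
      qed
      then show ?thesis by (simp add: ereal_minus_le)
    qed
  qed
qed

text \<open>As no summand is \<infinity>, a real lower bound on the sum forces every summand to be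
  real; concavity is then applied in each coordinate at points of the graph.\<close>

lemma ereal_concave_on_sum:
  fixes G :: "'d::finite \<Rightarrow> real \<Rightarrow> ereal"
  assumes "\<And>j. ereal_concave_on UNIV (G j)" and finite: "\<And>j q. G j q \<noteq> \<infinity>"
    and "convex A"
  shows "ereal_concave_on A (\<lambda>u::real^'d. \<Sum>j\<in>UNIV. G j (u $ j))"
  unfolding ereal_concave_on_def
proof (rule convexI, clarsimp, intro conjI)
  fix u v :: "real^'d" and s t a b :: real
  assume h: "ereal s \<le> (\<Sum>j\<in>UNIV. G j (u $ j))" "ereal t \<le> (\<Sum>j\<in>UNIV. G j (v $ j))"
    "0 \<le> a" "0 \<le> b" "a + b = 1" "u \<in> A" "v \<in> A"
  then show "a *\<^sub>R u + b *\<^sub>R v \<in> A" using \<open>convex A\<close> by (simp add: convexD)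
  have real: "\<exists>g. \<forall>j. G j (x $ j) = ereal (g j)" if "ereal r \<le> (\<Sum>j\<in>UNIV. G j (x $ j))" for r and x :: "real^'d"
  proof -
    have "G j (x $ j) \<noteq> - \<infinity>" for j
    proof
      assume "G j (x $ j) = - \<infinity>"
      then have "(\<Sum>j\<in>UNIV. G j (x $ j)) = - \<infinity>"
        using finite by (subst sum.remove[of _ j]) (auto simp: sum_Pinfty)
      with that show False by simp
    qed
    then have "\<forall>j. \<exists>g. G j (x $ j) = ereal g"
      using finite by (metis ereal_cases)
    then show ?thesis by metis
  qed
  obtain f g where fg: "\<And>j. G j (u $ j) = ereal (f j)" "\<And>j. G j (v $ j) = ereal (g j)"
    using real h by metis
  have "ereal (a * f j + b * g j) \<le> G j (a * u $ j + b * v $ j)" for j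
    using convexD[OF assms(1)[unfolded ereal_concave_on_def], of "(u $ j, f j)" j "(v $ j, g j)" a b] h fg
    by simp
  then have "(\<Sum>j\<in>UNIV. ereal (a * f j + b * g j)) \<le> (\<Sum>j\<in>UNIV. G j (a * u $ j + b * v $ j))"
    by (rule sum_mono)
  moreover have "a * s + b * t \<le> a * (\<Sum>j\<in>UNIV. f j) + b * (\<Sum>j\<in>UNIV. g j)"
    using h fg by (intro add_mono mult_left_mono) auto
  ultimately show "ereal (a * s + b * t) \<le> (\<Sum>j\<in>UNIV. G j (a * u $ j + b * v $ j))"
    by (auto simp: sum.distrib sum_distrib_left intro: order_trans[rotated])
qed

section \<open>Conjugates and the slope attached to a keep probability\<close>

text \<open>The negative of the usual concave conjugate \<open>inf (C * r - G r)\<close>, over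
  \<open>r \<ge> 0\<close> because \<open>r\<close> stands for a squared weight. For
  \<open>C = \<infinity>\<close> and \<open>G\<close> never \<infinity>, only \<open>r = 0\<close>
  counts and the value is \<open>G 0\<close>.\<close>

definition concave_conjugate :: "(real \<Rightarrow> ereal) \<Rightarrow> ereal \<Rightarrow> ereal" where
  "concave_conjugate G C = (SUP r\<in>{0..}. G r - C * ereal r)"

text \<open>Fenchel-Young inequality; if \<open>C * ereal q\<close> is \<infinity>, so is the
  right-hand side.\<close>

lemma concave_conjugate_ge:
  assumes "0 \<le> q" "0 \<le> C"
  shows "G q \<le> C * ereal q + concave_conjugate G C"
proof -
  have "G q - C * ereal q \<le> concave_conjugate G C"
    unfolding concave_conjugate_def by (rule SUP_upper) (use assms in simp)
  moreover have "0 \<le> C * ereal q" using assms by simp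
  ultimately show ?thesis
    by (cases "C * ereal q = \<infinity>") (auto simp: ereal_minus_le_iff add.commute)
qed

text \<open>Equality case of Fenchel-Young. Finiteness of \<open>C * ereal q\<close> allows it to be
  cancelled even if \<open>G q\<close> is infinite.\<close>

lemma concave_conjugate_eq:
  assumes "0 \<le> q" and fin: "\<bar>C * ereal q\<bar> \<noteq> \<infinity>"
    and sup: "\<And>r. 0 \<le> r \<Longrightarrow> G r - C * ereal r \<le> G q - C * ereal q"
  shows "C * ereal q + concave_conjugate G C = G q"
proof -
  have "concave_conjugate G C = G q - C * ereal q"
    unfolding concave_conjugate_def
    by (intro antisym SUP_least SUP_upper) (use assms in auto)
  then show ?thesis using fin by (cases "G q"; cases "C * ereal q") auto
qed

text \<open>With this value at a dropped coordinate, \<open>dual_slope lam \<alpha> * ereal 0 = 0\<close> and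
  \<open>dual_slope lam \<alpha> * ereal q = \<infinity>\<close> for \<open>q > 0\<close>, which is the convention of
  \<^const>\<open>expected_loss\<close>.\<close>

definition dual_slope :: "real \<Rightarrow> real \<Rightarrow> ereal" where
  "dual_slope lam \<alpha> = (if \<alpha> = 0 then \<infinity> else ereal ((1 / \<alpha> - 1) / (2 * lam)))"

lemma keep_prob_in: "0 < lam \<Longrightarrow> keep_prob lam e \<in> {0..1}"
  by (auto simp: keep_prob_def divide_simps add_nonneg_pos)

lemma dual_slope_nonneg: "0 < lam \<Longrightarrow> \<alpha> \<in> {0..1} \<Longrightarrow> 0 \<le> dual_slope lam \<alpha>"
  by (auto simp: dual_slope_def divide_simps)

text \<open>Where \<alpha>_j > 0, the noise coefficient \<open>(1 / \<alpha> $ j - 1) / 2\<close> is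
  \<open>lam\<close> times the slope. A dropped nonzero weight makes both sides \<infinity>.\<close>

lemma expected_loss_sq_loss:
  fixes X :: "real^'d^'n"
  assumes X: "diag_part ((1 / real CARD('n)) *\<^sub>R (transpose X ** X)) = mat 1"
    and Mask: "mask_family Mask" and lam: "0 < lam" and \<alpha>: "\<And>j. \<alpha> $ j \<in> {0..1}"
  shows "expected_loss Mask (sq_loss X y) w \<alpha>
    = ereal (sq_loss X y w) + ereal lam * (\<Sum>j\<in>UNIV. dual_slope lam (\<alpha> $ j) * ereal ((w $ j)\<^sup>2))"
proof (cases "\<exists>j. \<alpha> $ j = 0 \<and> w $ j \<noteq> 0")
  case True
  then obtain j where "\<alpha> $ j = 0" "w $ j \<noteq> 0" by blast
  then have "(\<Sum>j\<in>UNIV. dual_slope lam (\<alpha> $ j) * ereal ((w $ j)\<^sup>2)) = \<infinity>"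
    by (auto simp: sum_Pinfty dual_slope_def intro!: exI[of _ j])
  with True lam show ?thesis by (simp add: expected_loss_def)
next
  case False
  \<comment> \<open>If \<alpha>_j = 0, then \<open>w $ j = 0\<close> here and both sides
    vanish.\<close>
  have slope: "dual_slope lam (\<alpha> $ j) * ereal ((w $ j)\<^sup>2)
      = ereal ((1 / \<alpha> $ j - 1) / (2 * lam) * (w $ j)\<^sup>2)" for j
    using False by (auto simp: dual_slope_def)
  have "is_mask \<alpha> (Mask \<alpha>)" using Mask \<alpha> by (simp add: mask_family_def)
  with False have "(\<integral>s. sq_loss X y (s * w) \<partial>Mask \<alpha>)
      = sq_loss X y w + (\<Sum>k\<in>UNIV. (1 / \<alpha> $ k - 1) / 2 * (w $ k)\<^sup>2)"
    by (intro expected_sq_loss[OF X]) auto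
  also have "\<dots> = sq_loss X y w + lam * (\<Sum>k\<in>UNIV. (1 / \<alpha> $ k - 1) / (2 * lam) * (w $ k)\<^sup>2)"
    using lam by (simp add: sum_distrib_left)
  finally show ?thesis
    unfolding slope using False by (simp add: expected_loss_def)
qed

section \<open>Construction of the penalty and the regulariser\<close>

text \<open>The last conjunct excludes trivial infinite witnesses whenever the update keeps all
  nonzero weights; -\<infinity> stays possible where a weight is zero.\<close>

theorem corollary2:
  fixes X :: "real^'d^'n" and y :: "real^'n" and lam :: real
    and Mask :: "real^'d \<Rightarrow> (real^'d) measure"
    and H :: "(ennreal^'d) set"
    and eta_hat :: "real^'d \<Rightarrow> ennreal^'d"
    and eta_coord :: "'d \<Rightarrow> real \<Rightarrow> ennreal"
  assumes "diag_part ((1 / real CARD('n)) *\<^sub>R (transpose X ** X)) = mat 1"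
    and "lam > 0"
    and "mask_family Mask"
    and "\<And>w. eta_hat w \<in> H"
    and "\<And>w j. eta_hat w $ j = eta_coord j (w $ j)"
    and "\<And>j. \<exists>h. (\<forall>t. keep_prob lam (eta_coord j t) = h \<bar>t\<bar>) \<and>
                mono_on {0..} h \<and> h differentiable_on {0..}"
  shows "\<exists>(f :: ennreal^'d \<Rightarrow> ereal) (\<Omega> :: real^'d \<Rightarrow> ereal).
           separable_on H f \<and> separable_on UNIV \<Omega> \<and> concave_in_square \<Omega> \<and>
           (\<forall>w. is_arg_min (dropout_objective Mask (sq_loss X y) lam f w) (\<lambda>\<eta>. \<eta> \<in> H) (eta_hat w) \<and>
                (INF \<eta>\<in>H. dropout_objective Mask (sq_loss X y) lam f w \<eta>)
                  = ereal (sq_loss X y w) + ereal lam * \<Omega> w) \<and>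
           ((\<forall>j t. t \<noteq> 0 \<longrightarrow> keep_prob lam (eta_coord j t) > 0) \<longrightarrow>
              (\<forall>w. (\<forall>j. w $ j \<noteq> 0) \<longrightarrow> \<bar>\<Omega> w\<bar> \<noteq> \<infinity>))"
proof (cases "\<forall>j t. t \<noteq> 0 \<longrightarrow> keep_prob lam (eta_coord j t) > 0")
  case False
  \<comment> \<open>If the update drops some \<open>w $ j \<noteq> 0\<close>, the minimum at \<open>w\<close> is \<open>\<infinity>\<close>, so \<open>f\<close> is forced to be
    \<open>\<infinity>\<close> wherever no coordinate is dropped.\<close>
  have sep: "separable_on A (\<lambda>_::'b^'d. \<infinity>)" for A
    unfolding separable_on_def by (rule exI[of _ "\<lambda>_ _. \<infinity>"]) (simp add: sum_Pinfty[THEN iffD2])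
  \<comment> \<open>Every parameter then minimises, with \<Omega> = \<infinity>, and the finiteness
    clause is vacuous.\<close>
  have obj: "dropout_objective Mask (sq_loss X y) lam (\<lambda>_. \<infinity>) w \<eta> = \<infinity>" for w \<eta>
    using \<open>lam > 0\<close> by (simp add: dropout_objective_def)
  have "concave_in_square (\<lambda>_::real^'d. \<infinity>)"
    unfolding concave_in_square_def ereal_concave_on_def
    by (rule exI[of _ "\<lambda>_. \<infinity>"]) (auto intro!: convexI)
  moreover have "H \<noteq> {}" using assms(4) by blast
  ultimately show ?thesis
    using False assms(2,4)
    by (intro exI[of _ "\<lambda>_. \<infinity>"] conjI sep) (auto simp: is_arg_min_def obj)
next
  case True
  obtain h where h: "\<And>j t. keep_prob lam (eta_coord j t) = h j \<bar>t\<bar>" and mono: "\<And>j. mono_on {0..} (h j)"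
    using assms(6) by metis
  have h_pos: "0 < h j t" if "0 < t" for j t
    using True[rule_format, of t j] that by (simp add: h)
  have slope_mono: "(1 / b - 1) / (2 * lam) \<le> (1 / a - 1) / (2 * lam)" if "0 < a" "a \<le> b" for a b
    using that \<open>lam > 0\<close> by (intro divide_right_mono diff_right_mono) (auto simp: frac_le)
  \<comment> \<open>The last clause is the tangency needed for equality in Fenchel-Young at
    \<open>t\<^sup>2\<close>, with the slope prescribed by the update.\<close>
  have "\<exists>G. (\<forall>q. 0 < q \<longrightarrow> \<bar>G q\<bar> \<noteq> \<infinity>) \<and> (\<forall>q. G q \<noteq> \<infinity>) \<and> ereal_concave_on UNIV G \<and>
      (\<forall>t r. 0 \<le> r \<longrightarrow> G r - dual_slope lam (h j \<bar>t\<bar>) * ereal r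
        \<le> G (t\<^sup>2) - dual_slope lam (h j \<bar>t\<bar>) * ereal (t\<^sup>2))" for j
  proof -
    let ?c = "\<lambda>q. (1 / h j (sqrt q) - 1) / (2 * lam)"
    have "?c q \<le> ?c p" if "0 < p" "p \<le> q" for p q
      using that h_pos[of "sqrt p" j] mono[of j] by (intro slope_mono) (auto simp: monotone_on_def)
    then obtain G where G: "\<And>q. 0 < q \<Longrightarrow> \<bar>G q\<bar> \<noteq> \<infinity>" "\<And>q. G q \<noteq> \<infinity>" "ereal_concave_on UNIV G"
      and G_pos: "\<And>p r. 0 < p \<Longrightarrow> G r \<le> G p + ereal (?c p * (r - p))"
      and G_0: "\<And>C r. (\<And>p. 0 < p \<Longrightarrow> ?c p \<le> C) \<Longrightarrow> 0 \<le> r \<Longrightarrow> G r \<le> G 0 + ereal (C * r)"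
      using concave_envelope[of ?c] by metis
    have "G r - dual_slope lam (h j \<bar>t\<bar>) * ereal r
        \<le> G (t\<^sup>2) - dual_slope lam (h j \<bar>t\<bar>) * ereal (t\<^sup>2)" if "0 \<le> r" for t r
    proof -
      \<comment> \<open>For \<open>t \<noteq> 0\<close> the tangent at \<open>t\<^sup>2\<close>
        serves. At \<open>t = 0\<close> with slope \<infinity> only \<open>r = 0\<close> competes;
        otherwise monotonicity makes the slope at 0 a bound on all slopes.\<close>
      consider "t \<noteq> 0" | "t = 0" "h j 0 = 0" | "t = 0" "h j 0 \<noteq> 0" by blast
      then show ?thesis
      proof cases
        case 1
        define k where "k = (1 / h j \<bar>t\<bar> - 1) / (2 * lam)"
        have "dual_slope lam (h j \<bar>t\<bar>) = ereal k"
          using h_pos[of "\<bar>t\<bar>" j] 1 by (simp add: dual_slope_def k_def)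
        moreover have "G r \<le> G (t\<^sup>2) + ereal (k * (r - t\<^sup>2))"
          using G_pos[of "t\<^sup>2" r] 1 by (simp add: k_def)
        ultimately show ?thesis
          by (cases "G r"; cases "G (t\<^sup>2)") (auto simp: algebra_simps)
      next
        case 2
        then show ?thesis using that G(2)[of r]
          by (cases "r = 0") (auto simp: dual_slope_def ereal_minus_le_iff)
      next
        case 3
        define k where "k = (1 / h j 0 - 1) / (2 * lam)"
        have "h j 0 = keep_prob lam (eta_coord j 0)" by (simp add: h)
        then have "0 < h j 0" using keep_prob_in[OF \<open>lam > 0\<close>, of "eta_coord j 0"] 3 by simp
        then have "?c p \<le> k" if "0 < p" for p
          unfolding k_def using mono[of j] that by (intro slope_mono) (auto simp: monotone_on_def)
        from G_0[OF this \<open>0 \<le> r\<close>] 3 show ?thesis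
          by (simp add: dual_slope_def k_def ereal_minus_le)
      qed
    qed
    with G show ?thesis by blast
  qed
  then obtain G where G_fin: "\<And>j q. 0 < q \<Longrightarrow> \<bar>G j q\<bar> \<noteq> \<infinity>" and G_ub: "\<And>j q. G j q \<noteq> \<infinity>"
    and G_conc: "\<And>j. ereal_concave_on UNIV (G j)"
    and G_slope: "\<And>j t r. 0 \<le> r \<Longrightarrow> G j r - dual_slope lam (h j \<bar>t\<bar>) * ereal r
        \<le> G j (t\<^sup>2) - dual_slope lam (h j \<bar>t\<bar>) * ereal (t\<^sup>2)"
    by metis
  define C where "C e = dual_slope lam (keep_prob lam e)" for e
  \<comment> \<open>The factor 2 turns the weight \<open>lam / 2\<close> of the penalty into
    \<open>lam\<close>; inside the sum it leaves \<open>f\<close> visibly separable.\<close>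
  define f where "f \<eta> = (\<Sum>j\<in>UNIV. concave_conjugate (G j) (C (\<eta> $ j)) * ereal 2)" for \<eta> :: "ennreal^'d"
  define \<Omega> where "\<Omega> w = (\<Sum>j\<in>UNIV. G j ((w $ j)\<^sup>2))" for w :: "real^'d"
  have C_nonneg: "0 \<le> C e" for e
    unfolding C_def using dual_slope_nonneg keep_prob_in \<open>lam > 0\<close> by blast
  have sep: "separable_on H f" "separable_on UNIV \<Omega>"
    unfolding separable_on_def f_def \<Omega>_def
    by (intro exI[of _ "\<lambda>j e. concave_conjugate (G j) (C e) * ereal 2"] exI[of _ "\<lambda>j x. G j (x\<^sup>2)"], simp)+
  have "convex {u :: real^'d. \<forall>j. 0 \<le> u $ j}"
    by (auto intro!: convexI)
  then have conc: "concave_in_square \<Omega>"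
    unfolding concave_in_square_def \<Omega>_def
    by (intro exI[of _ "\<lambda>u. \<Sum>j\<in>UNIV. G j (u $ j)"] conjI ereal_concave_on_sum G_conc G_ub)
      (auto simp: power2_eq_square)
  have obj: "dropout_objective Mask (sq_loss X y) lam f w \<eta> = ereal (sq_loss X y w)
      + ereal lam * (\<Sum>j\<in>UNIV. C (\<eta> $ j) * ereal ((w $ j)\<^sup>2) + concave_conjugate (G j) (C (\<eta> $ j)))" for w \<eta>
  proof -
    have "ereal (lam / 2) * f \<eta> = ereal lam * (\<Sum>j\<in>UNIV. concave_conjugate (G j) (C (\<eta> $ j)))"
    proof -
      have "f \<eta> = (\<Sum>j\<in>UNIV. concave_conjugate (G j) (C (\<eta> $ j))) * ereal 2"
        unfolding f_def by (rule sum_distrib_right_ereal[symmetric]) simp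
      then have "ereal (lam / 2) * f \<eta>
          = (ereal (lam / 2) * ereal 2) * (\<Sum>j\<in>UNIV. concave_conjugate (G j) (C (\<eta> $ j)))"
        by (simp only: mult_ac)
      then show ?thesis by simp
    qed
    moreover have "ereal lam * (a + b) = ereal lam * a + ereal lam * b" for a b
      using distrib_left_ereal_nn[of lam a b] \<open>lam > 0\<close> by (simp add: mult.commute)
    ultimately show ?thesis
      unfolding dropout_objective_def
      by (subst expected_loss_sq_loss[OF assms(1,3,2)])
        (simp_all add: keep_prob_in \<open>lam > 0\<close> C_def sum.distrib add.assoc del: atLeastAtMost_iff)
  qed
  \<comment> \<open>Fenchel-Young in each coordinate.\<close>
  have lower: "ereal (sq_loss X y w) + ereal lam * \<Omega> w \<le> dropout_objective Mask (sq_loss X y) lam f w \<eta>" for w \<eta>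
    unfolding obj \<Omega>_def using \<open>lam > 0\<close>
    by (intro add_left_mono ereal_mult_left_mono sum_mono concave_conjugate_ge C_nonneg) auto
  have attained: "dropout_objective Mask (sq_loss X y) lam f w (eta_hat w)
      = ereal (sq_loss X y w) + ereal lam * \<Omega> w" for w
  proof -
    have "C (eta_coord j t) * ereal (t\<^sup>2) + concave_conjugate (G j) (C (eta_coord j t)) = G j (t\<^sup>2)" for j t
    proof (rule concave_conjugate_eq)
      \<comment> \<open>The slope is finite for \<open>t \<noteq> 0\<close>; at \<open>t = 0\<close>
        the product is 0 even if the slope is \<infinity>.\<close>
      show "\<bar>C (eta_coord j t) * ereal (t\<^sup>2)\<bar> \<noteq> \<infinity>"
        using h_pos[of "\<bar>t\<bar>" j] by (cases "t = 0") (auto simp: C_def h dual_slope_def)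
    qed (use G_slope in \<open>auto simp: C_def h\<close>)
    then show ?thesis by (simp add: obj \<Omega>_def assms(5))
  qed
  have "is_arg_min (dropout_objective Mask (sq_loss X y) lam f w) (\<lambda>\<eta>. \<eta> \<in> H) (eta_hat w)" for w
    using lower[of w] assms(4) by (auto simp: is_arg_min_def attained not_less)
  moreover have "(INF \<eta>\<in>H. dropout_objective Mask (sq_loss X y) lam f w \<eta>)
      = ereal (sq_loss X y w) + ereal lam * \<Omega> w" for w
    by (intro antisym INF_greatest lower INF_lower2[of "eta_hat w"])
      (simp_all add: assms(4) attained)
  moreover have "\<bar>\<Omega> w\<bar> \<noteq> \<infinity>" if "\<forall>j. w $ j \<noteq> 0" for w
    unfolding \<Omega>_def using that G_fin by (auto simp: sum_Inf)
  ultimately show ?thesis using sep conc by blast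
qed

end
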